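(* As formal power series in $q$, \[ \sum_{n\ge0}a_2''(n)q^n=\frac{q}{1-q^2}+\frac{1}{1+q}\sum_{n\ge0}\chi(n)q^{\binom{n+1}{2}+1}, \] where $\chi(n)=-1$ if $n\equiv0,1\pmod 4$ and $\chi(n)=1$ if $n\equiv2,3\pmod4$.
   Context: Notation: $(x;q^2)_0=1$ and $(x;q^2)_n=\prod_{j=0}^{n-1}(1-xq^{2j})$. Consider partitions of $n$ for which there are integers $l\ge2$, $1\le k\le l-1$ such that: there are exactly $l-1$ parts equal to $1$; the smallest even part is $2k$; every part greater than $1$ lies in the interval $[2k,2l-2]$; and the odd parts greater than $1$ are distinct. Then $a_2''(n)$ is the signed count of these partitions in which each partition is weighted by $(-1)^{j+1}$, where $j$ is its number of parts greater than $1$. Equivalently, \[ \sum_{n\ge0}a_2''(n)q^n=\sum_{\substack{l\ge2\\1\le k\le l-1}}\frac{(q^{2k+1};q^2)_{l-k-1}}{(-q^{2k};q^2)_{l-k}}q^{2k+l-1}. \] *)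

theory Defs
  imports
    "HOL-Computational_Algebra.Formal_Power_Series"
    "HOL-Library.Multiset"
begin

definition partitions_of :: "nat \<Rightarrow> nat multiset set" where
  "partitions_of n = {p. (\<forall>x\<in>#p. x > 0) \<and> sum_mset p = n}"

text \<open>The number of ones and the smallest even part of \<open>p\<close> determine \<open>l\<close> and \<open>k\<close>, so
  counting partitions agrees with summing over all pairs \<open>l\<close>, \<open>k\<close>.\<close>

definition admissible :: "nat multiset \<Rightarrow> bool" where
  "admissible p \<longleftrightarrow> (\<exists>l k. l \<ge> 2 \<and> 1 \<le> k \<and> k \<le> l - 1 \<and>
     count p 1 = l - 1 \<and>
     (2 * k \<in># p \<and> (\<forall>x\<in>#p. even x \<longrightarrow> 2 * k \<le> x)) \<and>
     (\<forall>x\<in>#p. x > 1 \<longrightarrow> x \<in> {2 * k..2 * l - 2}) \<and>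
     (\<forall>x\<in>#p. odd x \<and> x > 1 \<longrightarrow> count p x = 1))"

definition parts_gt_1 :: "nat multiset \<Rightarrow> nat" where
  "parts_gt_1 p = size (filter_mset (\<lambda>x. x > 1) p)"

definition a2'' :: "nat \<Rightarrow> int" where
  "a2'' n = (\<Sum>p | p \<in> partitions_of n \<and> admissible p. (- 1) ^ (parts_gt_1 p + 1))"

definition chi :: "nat \<Rightarrow> int" where
  "chi n = (if n mod 4 \<in> {0, 1} then - 1 else 1)"

text \<open>The sum defining \<open>a2''\<close> has a finite index set.\<close>

lemma finite_partitions_of: "finite (partitions_of n)"
proof (rule finite_subset)
  show "partitions_of n \<subseteq> mset ` {xs. set xs \<subseteq> {..n} \<and> length xs \<le> n}"
  proof
    fix p assume p: "p \<in> partitions_of n"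
    obtain xs where xs: "p = mset xs" by (metis ex_mset)
    have pos: "\<forall>x\<in>set xs. x > 0" and s: "sum_list xs = n"
      using p xs by (auto simp: partitions_of_def sum_mset_sum_list)
    have "length xs \<le> sum_list xs"
      using pos by (induction xs) auto
    moreover have "set xs \<subseteq> {..n}"
      using s member_le_sum_list by auto
    ultimately show "p \<in> mset ` {xs. set xs \<subseteq> {..n} \<and> length xs \<le> n}"
      using xs s by auto
  qed
qed (simp add: finite_lists_length_le)

end

theory Submission
  imports Defs
begin

unbundle fps_syntax

text \<open>
  Write \<open>q\<close> for the formal variable, and \<open>(x; q\<^sup>2)\<^sub>n\<close> for the product of the \<open>1 - x q\<^sup>2\<^sup>j\<close>
  with \<open>j < n\<close>.  Splitting an admissible partition by its number \<open>m = l - 1\<close> of ones gives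
  \<open>\<Sum> a\<^sub>2'' (n) q\<^sup>n = \<Sum>\<^sub>m q\<^sup>m T\<^sub>m\<close>, where \<open>T\<^sub>m\<close> counts, with sign, the partitions formed by the
  remaining parts: they are at most \<open>2 m\<close>, their odd parts are distinct, and their least part is
  even.  Two facts then determine the series.

  First, \<open>T\<^sub>m\<close> has a closed form.  The partitions bounded by \<open>2 m + 2\<close> arise from those bounded by
  \<open>2 m\<close> by allowing one part \<open>2 m + 1\<close> and arbitrarily many parts \<open>2 m + 2\<close>, except that the
  partitions using only the part \<open>2 m + 2\<close> are new.  This gives a first-order recurrence
  (\<open>signed_gf_even_min_partitions_Suc\<close>), solved by
  \<open>(1 + q) T\<^sub>m = q (1 - (q; q\<^sup>2)\<^sub>m / (-q\<^sup>2; q\<^sup>2)\<^sub>m)\<close> (\<open>signed_gf_even_min_partitions\<close>).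

  Summing over \<open>m\<close>, the constant \<open>1\<close> contributes \<open>q / (1 - q)\<close>, and what is left is
  \<open>-q G(q)\<close> with \<open>G(z) = \<Sum>\<^sub>n (z; q\<^sup>2)\<^sub>n / (-z q; q\<^sup>2)\<^sub>n z\<^sup>n\<close>.  Second, this \<open>G\<close> is a case of the
  Rogers--Fine function in which the functional equation degenerates to
  \<open>G(z) = 1 + z - z\<^sup>2 q G(z q\<^sup>2)\<close> (\<open>rogers_fine_recurrence\<close>).  Iterating it along
  \<open>z = q, q\<^sup>3, q\<^sup>5, \<dots>\<close> produces the false theta series
  \<open>\<Sum>\<^sub>m (-1)\<^sup>m q^(2 m\<^sup>2 + m) (1 + q^(2 m + 1))\<close>, whose exponents are the triangular numbers
  taken two at a time (\<open>sum_chi_pairs\<close>).  Division by \<open>1 + q\<close> yields the claim.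

  All infinite sums are handled by congruence: two series are equal if they agree modulo every
  \<open>q\<^sup>N\<close>, and modulo \<open>q\<^sup>N\<close> each sum may be cut off after finitely many terms.
\<close>

section \<open>Power series up to a given order\<close>

lemma fps_X_power_dvd_iff:
  fixes f :: "'a::field fps"
  shows "fps_X ^ N dvd f \<longleftrightarrow> (\<forall>k<N. f $ k = 0)"
proof
  assume "\<forall>k<N. f $ k = 0"
  then show "fps_X ^ N dvd f"
    by (cases "f = 0") (auto simp: fps_dvd_iff fps_X_power_subdegree intro!: subdegree_geI)
qed (auto simp: dvd_def fps_X_power_mult_nth)

lemma fps_eq_if_agree_mod_X_powers:
  fixes f g :: "'a::field fps"
  assumes "\<And>N. fps_X ^ N dvd f - g"
  shows "f = g"
proof (rule fps_ext)
  fix n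
  have "\<forall>k<Suc n. (f - g) $ k = 0"
    using assms[of "Suc n"] unfolding fps_X_power_dvd_iff .
  then show "f $ n = g $ n" by simp
qed

text \<open>
  Each coefficient of the infinite sum receives contributions from finitely many terms only, so
  the series converges in the metric on power series and its sum can be read off coefficientwise.
\<close>
lemma suminf_fps_agrees_partial_sum:
  fixes f :: "nat \<Rightarrow> 'a::field fps"
  assumes dvd: "\<And>n. fps_X ^ n dvd f n"
  shows "fps_X ^ N dvd suminf f - (\<Sum>n<N. f n)"
proof -
  have zero: "f n $ k = 0" if "k < n" for n k
    using dvd[of n] that by (simp add: fps_X_power_dvd_iff)
  have partial: "(\<Sum>n<M. f n $ k) = (\<Sum>n\<le>k. f n $ k)" if "k < M" for k M
    using that by (intro sum.mono_neutral_right) (auto intro: zero)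
  have "f sums Abs_fps (\<lambda>k. \<Sum>n\<le>k. f n $ k)"
    unfolding sums_def tendsto_fps_iff
  proof
    fix k
    show "\<forall>\<^sub>F M in sequentially.
        (\<Sum>n<M. f n) $ k = Abs_fps (\<lambda>k. \<Sum>n\<le>k. f n $ k) $ k"
      using eventually_gt_at_top[of k]
      by eventually_elim (simp add: fps_sum_nth partial)
  qed
  then have "suminf f = Abs_fps (\<lambda>k. \<Sum>n\<le>k. f n $ k)"
    by (rule sums_unique[symmetric])
  then show ?thesis
    by (simp add: fps_X_power_dvd_iff fps_sum_nth partial)
qed

section \<open>A degenerate case of the Rogers--Fine recurrence\<close>

text \<open>
  This is \<open>(z; q\<^sup>2)\<^sub>n / (-z q; q\<^sup>2)\<^sub>n\<close>, with \<open>q\<close> the formal variable.  The argument \<open>z\<close> is kept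
  free because the recurrence below replaces \<open>z\<close> by \<open>z q\<^sup>2\<close>.
\<close>
primrec qratio :: "'a::field fps \<Rightarrow> nat \<Rightarrow> 'a fps" where
  "qratio z 0 = 1"
| "qratio z (Suc n) = qratio z n * (1 - z * fps_X ^ (2 * n)) * inverse (1 + z * fps_X ^ (2 * n + 1))"

lemma denominator_nonzero: "(1 + z * fps_X ^ (2 * n + 1) :: 'a::field fps) $ 0 \<noteq> 0"
  by simp

text \<open>
  Clearing denominators keeps all later computations polynomial; a denominator is removed again
  with \<open>fps_mult_right_cancel_unit\<close>, since its constant term is \<open>1\<close>.
\<close>
lemma qratio_Suc_mult:
  "qratio z (Suc n) * (1 + z * fps_X ^ (2 * n + 1)) = qratio z n * (1 - z * fps_X ^ (2 * n))"
  using inverse_mult_eq_1[OF denominator_nonzero, of z n]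
  by (simp add: mult.assoc)

declare qratio.simps(2) [simp del]

lemma fps_mult_right_cancel_unit:
  fixes a b c :: "'a::field fps"
  assumes "c $ 0 \<noteq> 0" and "a * c = b * c"
  shows "a = b"
proof -
  have "c \<noteq> 0" using assms(1) by auto
  then show ?thesis using assms(2) by simp
qed

text \<open>
  Replacing \<open>z\<close> by \<open>z q\<^sup>2\<close> shifts both products by one factor, so only the first and the last
  factor of numerator and denominator survive in the quotient.
\<close>
lemma qratio_shift:
  "(1 - z) * (1 + z * fps_X ^ (2 * n + 1)) * qratio (z * fps_X\<^sup>2) n =
   (1 - z * fps_X ^ (2 * n)) * (1 + z * fps_X) * qratio z n"
proof (induction n)
  case (Suc n)
  define y where "y = (fps_X :: 'a fps) ^ (2 * n)"
  have step: "qratio (z * fps_X\<^sup>2) (Suc n) * (1 + z * fps_X\<^sup>2 * (fps_X * y)) =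
      qratio (z * fps_X\<^sup>2) n * (1 - z * fps_X\<^sup>2 * y)"
    and step': "qratio z (Suc n) * (1 + z * (fps_X * y)) = qratio z n * (1 - z * y)"
    using qratio_Suc_mult[of "z * fps_X\<^sup>2" n] qratio_Suc_mult[of z n] by (simp_all add: y_def)
  have IH: "(1 - z) * (1 + z * (fps_X * y)) * qratio (z * fps_X\<^sup>2) n =
      (1 - z * y) * (1 + z * fps_X) * qratio z n"
    using Suc.IH by (simp add: y_def)
  have "(1 - z) * (1 + z * (fps_X\<^sup>2 * (fps_X * y))) * qratio (z * fps_X\<^sup>2) (Suc n) *
      (1 + z * (fps_X * y)) =
      (1 - z * (fps_X\<^sup>2 * y)) * (1 + z * fps_X) * qratio z (Suc n) * (1 + z * (fps_X * y))"
    using step step' IH by algebra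
  moreover have "(1 + z * (fps_X * y)) $ 0 \<noteq> 0" by simp
  ultimately show ?case
    using fps_mult_right_cancel_unit by (fastforce simp: y_def power_add power2_eq_square mult.assoc)
qed simp

text \<open>
  With \<open>V\<^sub>n = qratio z n * z\<^sup>n * (1 - z\<^sup>2 q\<^sup>2\<^sup>n)\<close>, the \<open>n\<close>-th terms of the two sums combine, after
  multiplication by \<open>1 - z\<close>, to \<open>V\<^sub>n - V\<^sub>n\<^sub>+\<^sub>1\<close>.  The factor \<open>1 - z\<^sup>2 q\<^sup>2\<^sup>n\<close> is the solution, found by
  undetermined coefficients, that is linear in \<open>q\<^sup>2\<^sup>n\<close>.
\<close>
lemma rogers_fine_telescoped:
  "(1 - z) * ((\<Sum>n<N. qratio z n * z ^ n) +
      z\<^sup>2 * fps_X * (\<Sum>n<N. qratio (z * fps_X\<^sup>2) n * (z * fps_X\<^sup>2) ^ n)) =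
   (1 - z) * (1 + z) - qratio z N * z ^ N * (1 - z\<^sup>2 * fps_X ^ (2 * N))"
proof (induction N)
  case 0
  show ?case by (simp add: algebra_simps power2_eq_square)
next
  case (Suc n)
  define y where "y = (fps_X :: 'a fps) ^ (2 * n)"
  define w where "w = z ^ n"
  have pw: "(z * fps_X\<^sup>2) ^ n = w * y"
    by (simp add: w_def y_def power_mult_distrib power_mult)
  have shift: "(1 - z) * (1 + z * (fps_X * y)) * qratio (z * fps_X\<^sup>2) n =
      (1 - z * y) * (1 + z * fps_X) * qratio z n"
    using qratio_shift[of z n] by (simp add: y_def)
  have step: "qratio z (Suc n) * (1 + z * (fps_X * y)) = qratio z n * (1 - z * y)"
    using qratio_Suc_mult[of z n] by (simp add: y_def)
  \<comment> \<open>One telescoping step, first multiplied by the denominator that \<open>qratio z (Suc n)\<close> adds.\<close>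
  have "((1 - z) * (qratio z n * w + z\<^sup>2 * fps_X * (qratio (z * fps_X\<^sup>2) n * (w * y)))) *
      (1 + z * (fps_X * y)) =
      (qratio z n * w * (1 - z\<^sup>2 * y) - qratio z (Suc n) * (z * w) * (1 - z\<^sup>2 * (fps_X\<^sup>2 * y))) *
      (1 + z * (fps_X * y))"
    using shift step by algebra
  moreover have "(1 + z * (fps_X * y)) $ 0 \<noteq> 0" by simp
  ultimately have "(1 - z) * (qratio z n * w + z\<^sup>2 * fps_X * (qratio (z * fps_X\<^sup>2) n * (w * y))) =
      qratio z n * w * (1 - z\<^sup>2 * y) - qratio z (Suc n) * (z * w) * (1 - z\<^sup>2 * (fps_X\<^sup>2 * y))"
    using fps_mult_right_cancel_unit by blast
  moreover have pow: "fps_X ^ (2 * Suc n) = fps_X\<^sup>2 * y" "z ^ Suc n = z * w"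
    by (simp_all add: y_def w_def power2_eq_square mult.assoc)
  moreover have split: "(1 - z) * ((S + a) + d * (T + b)) = (1 - z) * (S + d * T) + (1 - z) * (a + d * b)"
    for S a d T b by (simp add: algebra_simps)
  ultimately show ?case
    using Suc.IH unfolding sum.lessThan_Suc pw pow w_def[symmetric] y_def[symmetric] split by simp
qed

text \<open>
  This is \<open>G(z) = 1 + z - z\<^sup>2 q G(z q\<^sup>2)\<close> up to order \<open>N\<close>: the boundary term left by telescoping
  contains \<open>z\<^sup>N\<close>, and \<open>1 - z\<close> can be divided out because \<open>z\<close> has no constant term.
\<close>
lemma rogers_fine_recurrence:
  fixes z :: "'a::field fps"
  assumes "fps_X dvd z"
  shows "fps_X ^ N dvd (\<Sum>n<N. qratio z n * z ^ n) -
    (1 + z - z\<^sup>2 * fps_X * (\<Sum>n<N. qratio (z * fps_X\<^sup>2) n * (z * fps_X\<^sup>2) ^ n))"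
    (is "_ dvd ?D")
proof -
  have "(1 - z) * ?D = - (qratio z N * (1 - z\<^sup>2 * fps_X ^ (2 * N))) * z ^ N"
    using rogers_fine_telescoped[of z N] by (simp add: algebra_simps)
  moreover have "fps_X ^ N dvd z ^ N" using assms by (rule dvd_power_same)
  ultimately have "fps_X ^ N dvd (1 - z) * ?D" by simp
  moreover have "z $ 0 = 0"
    using assms fps_X_power_dvd_iff[of 1 z] by simp
  then have "(1 - z) dvd 1" by simp
  ultimately show ?thesis
    by (simp add: dvd_mult_unit_iff')
qed

text \<open>
  Each use of the recurrence at \<open>z = q\<^sup>2\<^sup>m\<^sup>+\<^sup>1\<close> contributes \<open>1 + z\<close> and a factor
  \<open>-z\<^sup>2 q = -q\<^sup>4\<^sup>m\<^sup>+\<^sup>3\<close>; the product of the first \<open>m\<close> such factors has exponent \<open>2 m\<^sup>2 + m\<close>.  After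
  \<open>N\<close> steps the remainder is divisible by \<open>q\<^sup>N\<close>.
\<close>
lemma false_theta_expansion:
  fixes N :: nat
  shows "fps_X ^ N dvd (\<Sum>n<N. qratio fps_X n * fps_X ^ n) -
    (\<Sum>m<N. (- 1) ^ m * fps_X ^ (2 * m\<^sup>2 + m) * (1 + fps_X ^ (2 * m + 1)) :: 'a::field fps)"
proof -
  define G :: "nat \<Rightarrow> 'a fps" where
    "G m = (\<Sum>n<N. qratio (fps_X ^ (2 * m + 1)) n * (fps_X ^ (2 * m + 1)) ^ n)" for m
  define s :: "nat \<Rightarrow> 'a fps" where "s m = (- 1) ^ m * fps_X ^ (2 * m\<^sup>2 + m)" for m
  have s_Suc: "s (Suc m) = - (s m * ((fps_X ^ (2 * m + 1))\<^sup>2 * fps_X))" for m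
  proof -
    have "2 * (Suc m)\<^sup>2 + Suc m = (2 * m\<^sup>2 + m) + ((2 * m + 1) * 2 + 1)"
      by (simp add: power2_eq_square algebra_simps)
    then have "fps_X ^ (2 * (Suc m)\<^sup>2 + Suc m) =
        (fps_X ^ (2 * m\<^sup>2 + m) * ((fps_X ^ (2 * m + 1))\<^sup>2 * fps_X) :: 'a fps)"
      by (simp only: power_add power_mult power_one_right)
    then show ?thesis
      by (simp only: s_def power_Suc[of "- 1" m] mult_minus_left mult_1_left mult.assoc)
  qed
  have rec: "fps_X ^ N dvd G m - (1 + fps_X ^ (2 * m + 1)
      - (fps_X ^ (2 * m + 1))\<^sup>2 * fps_X * G (Suc m))" for m
  proof -
    have "fps_X ^ (2 * Suc m + 1) = (fps_X ^ (2 * m + 1) * fps_X\<^sup>2 :: 'a fps)"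
      by (simp add: power2_eq_square mult_ac)
    moreover have "fps_X dvd (fps_X ^ (2 * m + 1) :: 'a fps)" by simp
    ultimately show ?thesis
      using rogers_fine_recurrence[of "fps_X ^ (2 * m + 1)" N] unfolding G_def by (simp only:)
  qed
  have iter: "fps_X ^ N dvd G 0 - ((\<Sum>m<M. s m * (1 + fps_X ^ (2 * m + 1))) + s M * G M)" for M
  proof (induction M)
    case (Suc M)
    have "G 0 - ((\<Sum>m<Suc M. s m * (1 + fps_X ^ (2 * m + 1))) + s (Suc M) * G (Suc M)) =
      (G 0 - ((\<Sum>m<M. s m * (1 + fps_X ^ (2 * m + 1))) + s M * G M)) +
      s M * (G M - (1 + fps_X ^ (2 * M + 1) - (fps_X ^ (2 * M + 1))\<^sup>2 * fps_X * G (Suc M)))"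
      by (simp only: s_Suc sum.lessThan_Suc) (simp add: algebra_simps)
    then show ?case
      using dvd_add[OF Suc.IH dvd_mult[OF rec[of M], of "s M"]] by (simp only:)
  qed (simp add: s_def)
  have "fps_X ^ N dvd s N * G N"
    unfolding s_def by (intro dvd_mult2 dvd_mult le_imp_power_dvd) simp
  with iter[of N] have "fps_X ^ N dvd
      G 0 - ((\<Sum>m<N. s m * (1 + fps_X ^ (2 * m + 1))) + s N * G N) + s N * G N"
    by (rule dvd_add)
  then show ?thesis by (simp add: G_def s_def)
qed

text \<open>
  The triangular numbers with indices \<open>2 m\<close> and \<open>2 m + 1\<close> are \<open>2 m\<^sup>2 + m\<close> and
  \<open>2 m\<^sup>2 + m + (2 m + 1)\<close>, and \<open>chi\<close> takes the value \<open>-(-1)\<^sup>m\<close> at both indices.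
\<close>
lemma sum_chi_pairs:
  "(\<Sum>n<2 * N. fps_const (of_int (chi n)) * fps_X ^ ((n + 1 choose 2) + 1)) =
   - fps_X * (\<Sum>m<N. (- 1) ^ m * fps_X ^ (2 * m\<^sup>2 + m) * (1 + fps_X ^ (2 * m + 1)) :: 'a::field fps)"
proof (induction N)
  case (Suc N)
  have c: "chi (2 * N) = - ((- 1) ^ N)" "chi (Suc (2 * N)) = - ((- 1) ^ N)"
  proof -
    have "(2 * N) mod 4 = 2 * (N mod 2)" "Suc (2 * N) mod 4 = 2 * (N mod 2) + 1" by presburger+
    then show "chi (2 * N) = - ((- 1) ^ N)" "chi (Suc (2 * N)) = - ((- 1) ^ N)"
      by (auto simp: chi_def minus_one_power_iff mod2_eq_if)
  qed
  have e: "(2 * N + 1) choose 2 = 2 * N\<^sup>2 + N" "(Suc (2 * N) + 1) choose 2 = 2 * N\<^sup>2 + N + (2 * N + 1)"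
  proof -
    have "(2 * N + 1) * (2 * N) = 2 * (2 * N\<^sup>2 + N)"
      "(2 * N + 2) * (2 * N + 1) = 2 * (2 * N\<^sup>2 + N + (2 * N + 1))"
      by (simp_all add: power2_eq_square algebra_simps)
    then show "(2 * N + 1) choose 2 = 2 * N\<^sup>2 + N"
      "(Suc (2 * N) + 1) choose 2 = 2 * N\<^sup>2 + N + (2 * N + 1)"
      by (simp_all add: choose_two)
  qed
  have sgn: "fps_const (of_int (- ((- 1) ^ N))) = (- ((- 1) ^ N) :: 'a fps)"
    by (cases "even N") (simp_all flip: fps_const_neg)
  have "(\<Sum>n<2 * Suc N. fps_const (of_int (chi n)) * fps_X ^ ((n + 1 choose 2) + 1)) =
     (\<Sum>n<2 * N. fps_const (of_int (chi n)) * fps_X ^ ((n + 1 choose 2) + 1)) +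
     (- ((- 1) ^ N)) * fps_X ^ (2 * N\<^sup>2 + N + 1) +
     (- ((- 1) ^ N)) * (fps_X ^ (2 * N\<^sup>2 + N + (2 * N + 1) + 1) :: 'a fps)"
    by (simp only: mult_Suc_right add_2_eq_Suc sum.lessThan_Suc c e sgn)
  also note Suc.IH
  finally show ?case
    unfolding sum.lessThan_Suc power_add power_one_right
    by (rule trans) (simp only: ring_distribs, simp add: mult_ac)
qed simp

section \<open>The signed generating function of a set of partitions\<close>

text \<open>
  The sign is \<open>(-1)\<^sup>j\<close>, where \<open>j\<close> is the number of parts greater than \<open>1\<close>, rather than the
  \<open>(-1)\<^sup>j\<^sup>+\<^sup>1\<close> of \<open>a2''\<close>.  This makes it multiplicative: adding a part \<open>x > 1\<close> always multiplies
  by \<open>-q\<^sup>x\<close>.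
\<close>
definition signed_gf :: "nat multiset set \<Rightarrow> rat fps" where
  "signed_gf S = Abs_fps (\<lambda>n. \<Sum>p | p \<in> S \<and> sum_mset p = n. (- 1) ^ parts_gt_1 p)"

text \<open>With parts equal to \<open>0\<close>, a coefficient could be a sum over an infinite set, which defaults to \<open>0\<close>.\<close>
lemma finite_fixed_sum:
  fixes S :: "nat multiset set"
  assumes "\<And>p. p \<in> S \<Longrightarrow> 0 \<notin># p"
  shows "finite {p. p \<in> S \<and> sum_mset p = n}"
proof (rule finite_subset[OF _ finite_partitions_of])
  show "{p. p \<in> S \<and> sum_mset p = n} \<subseteq> partitions_of n"
    using assms by (fastforce simp: partitions_of_def intro: gr0I)
qed

lemma signed_gf_UN:
  assumes "finite I" and "\<And>i p. i \<in> I \<Longrightarrow> p \<in> A i \<Longrightarrow> 0 \<notin># p"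
    and "\<And>i j. i \<in> I \<Longrightarrow> j \<in> I \<Longrightarrow> i \<noteq> j \<Longrightarrow> A i \<inter> A j = {}"
  shows "signed_gf (\<Union>i\<in>I. A i) = (\<Sum>i\<in>I. signed_gf (A i))"
proof (rule fps_ext)
  fix n
  have "{p. p \<in> (\<Union>i\<in>I. A i) \<and> sum_mset p = n} = (\<Union>i\<in>I. {p. p \<in> A i \<and> sum_mset p = n})"
    by auto
  moreover have "(\<Sum>p\<in>(\<Union>i\<in>I. {p. p \<in> A i \<and> sum_mset p = n}). (- 1) ^ parts_gt_1 p) =
      (\<Sum>i\<in>I. \<Sum>p | p \<in> A i \<and> sum_mset p = n. (- 1) ^ parts_gt_1 p :: rat)"
  proof (rule sum.UNION_disjoint)
    show "\<forall>i\<in>I. \<forall>j\<in>I. i \<noteq> j \<longrightarrow>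
        {p. p \<in> A i \<and> sum_mset p = n} \<inter> {p. p \<in> A j \<and> sum_mset p = n} = {}"
      using assms(3) by blast
  qed (use assms(1,2) finite_fixed_sum in blast)+
  ultimately show "signed_gf (\<Union>i\<in>I. A i) $ n = (\<Sum>i\<in>I. signed_gf (A i)) $ n"
    by (simp add: signed_gf_def fps_sum_nth)
qed

lemma signed_gf_Un:
  assumes "\<And>p. p \<in> A \<union> B \<Longrightarrow> 0 \<notin># p" and "A \<inter> B = {}"
  shows "signed_gf (A \<union> B) = signed_gf A + signed_gf B"
proof -
  have "signed_gf (\<Union>b\<in>UNIV. if b then A else B) = (\<Sum>b\<in>UNIV. signed_gf (if b then A else B))"
    using assms by (intro signed_gf_UN) (auto split: if_splits)
  then show ?thesis by (simp add: UNIV_bool Un_commute add.commute)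
qed

lemma signed_gf_empty: "signed_gf {} = 0"
  by (rule fps_ext) (simp add: signed_gf_def)

lemma signed_gf_empty_partition: "signed_gf {{#}} = 1"
proof (rule fps_ext)
  fix n :: nat
  have "{p. p \<in> {{#}} \<and> sum_mset p = n} = (if n = 0 then {{#}} else {})" by auto
  then show "signed_gf {{#}} $ n = 1 $ n"
    by (simp add: signed_gf_def parts_gt_1_def)
qed

lemma signed_gf_add_part:
  "signed_gf (add_mset x ` A) = (if x > 1 then - 1 else 1) * fps_X ^ x * signed_gf A"
proof (rule fps_ext)
  fix n
  have w: "(- 1) ^ parts_gt_1 (add_mset x p) =
      (if x > 1 then - 1 else 1) * ((- 1) ^ parts_gt_1 p :: rat)" for p
    by (simp add: parts_gt_1_def)
  show "signed_gf (add_mset x ` A) $ n =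
      ((if x > 1 then - 1 else 1) * fps_X ^ x * signed_gf A) $ n"
  proof (cases "n < x")
    case True
    then have "{p. p \<in> add_mset x ` A \<and> sum_mset p = n} = {}" by auto
    then have "signed_gf (add_mset x ` A) $ n = 0"
      unfolding signed_gf_def by (simp only: fps_nth_Abs_fps sum.empty)
    with True show ?thesis by (simp add: fps_X_power_mult_nth)
  next
    case False
    then have eq: "{p. p \<in> add_mset x ` A \<and> sum_mset p = n} =
        add_mset x ` {p. p \<in> A \<and> sum_mset p = n - x}" by auto
    have "inj_on (add_mset x) {p. p \<in> A \<and> sum_mset p = n - x}" by (simp add: inj_on_def)
    then have "signed_gf (add_mset x ` A) $ n =
        (\<Sum>p | p \<in> A \<and> sum_mset p = n - x. (- 1) ^ parts_gt_1 (add_mset x p))"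
      unfolding signed_gf_def fps_nth_Abs_fps eq by (simp only: sum.reindex comp_def)
    also have "\<dots> = (if x > 1 then - 1 else 1) * signed_gf A $ (n - x)"
      unfolding w signed_gf_def fps_nth_Abs_fps sum_distrib_left ..
    finally show ?thesis using False by (simp add: fps_X_power_mult_nth)
  qed
qed

section \<open>Partitions by their number of ones\<close>

text \<open>
  These are the multisets formed by the parts greater than \<open>1\<close> of an admissible partition with
  exactly \<open>m\<close> ones.  The admissibility conditions that \<open>2 k\<close> is the least even part and that all
  parts greater than \<open>1\<close> are at least \<open>2 k\<close> say together that \<open>2 k\<close> is the least of these parts.
\<close>
definition even_min_partitions :: "nat \<Rightarrow> nat multiset set" where
  "even_min_partitions m = {p. (\<exists>k\<ge>1. 2 * k \<in># p \<and> (\<forall>x\<in>#p. 2 * k \<le> x)) \<and>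
     (\<forall>x\<in>#p. x \<le> 2 * m) \<and> (\<forall>x\<in>#p. odd x \<longrightarrow> count p x = 1)}"

lemma even_min_partitionsI:
  assumes "1 \<le> k" and "2 * k \<in># p" and "\<And>x. x \<in># p \<Longrightarrow> 2 * k \<le> x"
    and "\<And>x. x \<in># p \<Longrightarrow> x \<le> 2 * m" and "\<And>x. x \<in># p \<Longrightarrow> odd x \<Longrightarrow> count p x = 1"
  shows "p \<in> even_min_partitions m"
  using assms unfolding even_min_partitions_def by blast

lemma even_min_partitions_parts_gt_1:
  "p \<in> even_min_partitions m \<Longrightarrow> x \<in># p \<Longrightarrow> x > 1"
  unfolding even_min_partitions_def by force

lemma even_min_partitions_0: "even_min_partitions 0 = {}"
proof -
  have False if p: "p \<in> even_min_partitions 0" for p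
  proof -
    obtain x where "x \<in># p" "x \<le> 2 * 0"
      using p unfolding even_min_partitions_def by blast
    with even_min_partitions_parts_gt_1[OF p] show False by force
  qed
  then show ?thesis by blast
qed

text \<open>
  The cases are: no new part, a part \<open>2 m + 1\<close> but no part \<open>2 m + 2\<close>, and at least one part
  \<open>2 m + 2\<close>.  In the last case only one copy is removed, so the set itself reappears on the right,
  which avoids summing over the multiplicity.  Removing an odd part never removes the least
  part, since that is even; removing a part \<open>2 m + 2\<close> can only do so if it was the only size.
\<close>
lemma even_min_partitions_Suc:
  "even_min_partitions (Suc m) =
    (even_min_partitions m \<union> add_mset (2 * m + 1) ` even_min_partitions m) \<union>
    add_mset (2 * m + 2) ` ({{#}} \<union> even_min_partitions (Suc m))"
  (is "?L' = (?L \<union> ?O) \<union> ?E")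
proof (intro equalityI subsetI)
  fix p assume p: "p \<in> ?L'"
  then obtain k where k: "k \<ge> 1" "2 * k \<in># p" "\<forall>x\<in>#p. 2 * k \<le> x"
    and le: "\<forall>x\<in>#p. x \<le> 2 * m + 2" and odd1: "\<forall>x\<in>#p. odd x \<longrightarrow> count p x = 1"
    by (auto simp: even_min_partitions_def)
  show "p \<in> (?L \<union> ?O) \<union> ?E"
  proof (cases "2 * m + 2 \<in># p")
    case True
    then obtain r where r: "p = add_mset (2 * m + 2) r" by (metis insert_DiffM)
    have "r \<in> ?L'" if "r \<noteq> {#}"
    proof -
      have "\<exists>k'\<ge>1. 2 * k' \<in># r \<and> (\<forall>x\<in>#r. 2 * k' \<le> x)"
      proof (cases "2 * k \<in># r")
        case True
        then show ?thesis using k r by auto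
      next
        case False
        \<comment> \<open>The least part was the largest allowed one, so all parts are \<open>2 m + 2\<close>.\<close>
        with k r have "2 * k = 2 * m + 2" by auto
        then have all: "x = 2 * m + 2" if "x \<in># r" for x using k le r that by force
        with \<open>r \<noteq> {#}\<close> have "2 * m + 2 \<in># r" by (metis multiset_nonemptyE)
        moreover have "2 * (m + 1) \<le> x" if "x \<in># r" for x using all[OF that] by (simp only: distrib_left mult_1_right order_refl)
        ultimately show ?thesis by (intro exI[of _ "m + 1"]) auto
      qed
      moreover have "\<forall>x\<in>#r. odd x \<longrightarrow> count r x = 1"
      proof (intro ballI impI)
        fix x assume "x \<in># r" "odd x"
        then have "count p x = 1" "x \<noteq> 2 * m + 2" using odd1 r by auto
        then show "count r x = 1" using r by simp
      qed
      ultimately show ?thesis using le r by (auto simp: even_min_partitions_def)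
    qed
    then show ?thesis using r by auto
  next
    case no: False
    have le': "x \<le> 2 * m + 1" if "x \<in># p" for x
    proof -
      have "x \<noteq> 2 * m + 2" using no that by auto
      moreover have "x \<le> 2 * m + 2" using le that by blast
      ultimately show ?thesis by simp
    qed
    show ?thesis
    proof (cases "2 * m + 1 \<in># p")
      case False
      then have "\<forall>x\<in>#p. x \<le> 2 * m" using le' by (metis le_SucE Suc_eq_plus1)
      then have "p \<in> ?L" using k odd1 by (auto simp: even_min_partitions_def)
      then show ?thesis by simp
    next
      case True
      then obtain r where r: "p = add_mset (2 * m + 1) r" by (metis insert_DiffM)
      have "count p (2 * m + 1) = 1" using odd1 True by simp
      then have nr: "2 * m + 1 \<notin># r" using r by (simp add: count_eq_zero_iff)
      have "2 * k \<noteq> 2 * m + 1" by presburger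
      then have "2 * k \<in># r" using k r by auto
      moreover have "\<forall>x\<in>#r. x \<le> 2 * m"
        using le' nr r by (metis le_SucE Suc_eq_plus1 insert_iff set_mset_add_mset_insert)
      moreover have "\<forall>x\<in>#r. odd x \<longrightarrow> count r x = 1"
      proof (intro ballI impI)
        fix x assume "x \<in># r" "odd x"
        then have "count p x = 1" "x \<noteq> 2 * m + 1" using odd1 r nr by auto
        then show "count r x = 1" using r by simp
      qed
      ultimately have "r \<in> ?L" using k r by (auto simp: even_min_partitions_def)
      then show ?thesis using r by auto
    qed
  qed
next
  fix p assume "p \<in> (?L \<union> ?O) \<union> ?E"
  then consider (old) "p \<in> ?L" | (odd) r where "r \<in> ?L" "p = add_mset (2 * m + 1) r"
    | (one) "p = {#2 * m + 2#}" | (even) r where "r \<in> ?L'" "p = add_mset (2 * m + 2) r" by auto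
  then show "p \<in> ?L'"
  proof cases
    case old
    moreover have "2 * m \<le> 2 * Suc m" by simp
    ultimately show ?thesis
      unfolding even_min_partitions_def using le_trans by blast
  next
    case odd
    from odd(1) obtain k where k: "k \<ge> 1" "2 * k \<in># r" "\<forall>x\<in>#r. 2 * k \<le> x"
      and le: "\<forall>x\<in>#r. x \<le> 2 * m" and odd1: "\<forall>x\<in>#r. odd x \<longrightarrow> count r x = 1"
      by (auto simp: even_min_partitions_def)
    have "2 * m + 1 \<notin># r" using le by force
    then have odd1': "\<forall>x\<in>#p. odd x \<longrightarrow> count p x = 1"
      using odd1 odd(2) by (simp add: not_in_iff)
    have "2 * k \<le> 2 * m" using k le by blast
    with k le odd1' show ?thesis
      unfolding odd(2) by (intro even_min_partitionsI[of k]) auto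
  next
    case one
    then show ?thesis by (intro even_min_partitionsI[of "m + 1"]) auto
  next
    case even
    from even(1) obtain k where k: "k \<ge> 1" "2 * k \<in># r" "\<forall>x\<in>#r. 2 * k \<le> x"
      and le: "\<forall>x\<in>#r. x \<le> 2 * m + 2" and odd1: "\<forall>x\<in>#r. odd x \<longrightarrow> count r x = 1"
      by (auto simp: even_min_partitions_def)
    have odd1': "\<forall>x\<in>#p. odd x \<longrightarrow> count p x = 1"
    proof (intro ballI impI)
      fix x assume "x \<in># p" "odd x"
      then have "x \<in># r" "x \<noteq> 2 * m + 2" using even(2) by auto
      then show "count p x = 1" using odd1 even(2) \<open>odd x\<close> by simp
    qed
    have "2 * k \<le> 2 * m + 2" using k le by blast
    with k le odd1' show ?thesis
      unfolding even(2) by (intro even_min_partitionsI[of k]) auto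
  qed
qed

lemma signed_gf_even_min_partitions_Suc:
  "(1 + fps_X ^ (2 * m + 2)) * signed_gf (even_min_partitions (Suc m)) =
   (1 - fps_X ^ (2 * m + 1)) * signed_gf (even_min_partitions m) - fps_X ^ (2 * m + 2)"
proof -
  let ?L = "even_min_partitions m" and ?L' = "even_min_partitions (Suc m)"
  let ?O = "add_mset (2 * m + 1) ` ?L" and ?E = "add_mset (2 * m + 2) ` ({{#}} \<union> ?L')"
  have pos: "p \<in> even_min_partitions j \<Longrightarrow> 0 \<notin># p" for p j
    using even_min_partitions_parts_gt_1 by fastforce
  have le: "p \<in> ?L \<Longrightarrow> x \<in># p \<Longrightarrow> x \<le> 2 * m" for p x
    by (auto simp: even_min_partitions_def)
  have notin_L: "2 * m + 1 \<notin># p" "2 * m + 2 \<notin># p" if "p \<in> ?L" for p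
    using le[OF that, of "2 * m + 1"] le[OF that, of "2 * m + 2"] by auto
  have "2 * m + 1 \<in># p" if "p \<in> ?O" for p using that by auto
  with notin_L(1) have d1: "?L \<inter> ?O = {}" by blast
  have "2 * m + 2 \<notin># p" if "p \<in> ?L \<union> ?O" for p using that notin_L(2) by auto
  moreover have "2 * m + 2 \<in># p" if "p \<in> ?E" for p using that by auto
  ultimately have d2: "(?L \<union> ?O) \<inter> ?E = {}" by blast
  have d3: "{{#}} \<inter> ?L' = {}" by (simp add: even_min_partitions_def)
  have "signed_gf ?L' = signed_gf ((?L \<union> ?O) \<union> ?E)"
    by (subst even_min_partitions_Suc) (rule refl)
  also have "\<dots> = signed_gf (?L \<union> ?O) + signed_gf ?E"
    by (rule signed_gf_Un[OF _ d2]) (auto dest: pos)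
  also have "signed_gf (?L \<union> ?O) = signed_gf ?L + signed_gf ?O"
    by (rule signed_gf_Un[OF _ d1]) (auto dest: pos)
  also have "signed_gf ?O = - (fps_X ^ (2 * m + 1) * signed_gf ?L)"
    by (cases m) (simp_all add: signed_gf_add_part even_min_partitions_0 signed_gf_empty)
  also have "signed_gf ?E = - (fps_X ^ (2 * m + 2) * signed_gf ({{#}} \<union> ?L'))"
    by (subst signed_gf_add_part) simp
  also have "signed_gf ({{#}} \<union> ?L') = 1 + signed_gf ?L'"
    by (subst signed_gf_Un[OF _ d3]) (auto dest: pos simp: signed_gf_empty_partition)
  finally show ?thesis by (simp add: algebra_simps)
qed

text \<open>
  This is the closed form of \<open>T\<^sub>m\<close>, with the opposite sign.  It is found by writing \<open>T\<^sub>m\<close> as a sum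
  over the least part \<open>2 k\<close>, which telescopes; given the formula, the recurrence confirms it.
\<close>
lemma signed_gf_even_min_partitions:
  "(1 + fps_X) * signed_gf (even_min_partitions m) = fps_X * (qratio fps_X m - 1)"
proof (induction m)
  case 0
  show ?case by (simp add: even_min_partitions_0 signed_gf_empty)
next
  case (Suc m)
  define y where "y = (fps_X :: rat fps) ^ (2 * m)"
  have "(1 + fps_X * (fps_X * y)) * signed_gf (even_min_partitions (Suc m)) =
      (1 - fps_X * y) * signed_gf (even_min_partitions m) - fps_X * (fps_X * y)"
    using signed_gf_even_min_partitions_Suc[of m] by (simp add: y_def)
  moreover have "qratio fps_X (Suc m) * (1 + fps_X * (fps_X * y)) =
      qratio fps_X m * (1 - fps_X * y)"
    using qratio_Suc_mult[of fps_X m] by (simp add: y_def)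
  ultimately have "(1 + fps_X) * signed_gf (even_min_partitions (Suc m)) * (1 + fps_X * (fps_X * y)) =
      fps_X * (qratio fps_X (Suc m) - 1) * (1 + fps_X * (fps_X * y))"
    using Suc.IH by algebra
  moreover have "(1 + fps_X * (fps_X * y)) $ 0 \<noteq> 0" by simp
  ultimately show ?case using fps_mult_right_cancel_unit by blast
qed

definition admissible_with_ones :: "nat \<Rightarrow> nat multiset set" where
  "admissible_with_ones m = (add_mset 1 ^^ m) ` even_min_partitions m"

lemma funpow_add_mset: "(add_mset x ^^ m) p = replicate_mset m x + p"
  by (induction m) simp_all

lemma signed_gf_admissible_with_ones:
  "signed_gf (admissible_with_ones m) = fps_X ^ m * signed_gf (even_min_partitions m)"
proof -
  have "signed_gf ((add_mset 1 ^^ j) ` A) = fps_X ^ j * signed_gf A" for j A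
  proof (induction j)
    case (Suc j)
    have "(add_mset 1 ^^ Suc j) ` A = add_mset 1 ` ((add_mset 1 ^^ j) ` A)"
      by (simp only: funpow.simps image_comp)
    then show ?case using Suc.IH by (simp only: signed_gf_add_part) simp
  qed simp
  then show ?thesis by (simp add: admissible_with_ones_def)
qed

lemma admissible_with_ones_count_1:
  assumes "p \<in> admissible_with_ones m"
  shows "count p 1 = m"
proof -
  from assms obtain r where "r \<in> even_min_partitions m" "p = replicate_mset m 1 + r"
    by (auto simp: admissible_with_ones_def funpow_add_mset)
  with even_min_partitions_parts_gt_1[of r m 1] show ?thesis
    by (auto simp: count_eq_zero_iff)
qed

lemma admissible_iff: "admissible p \<longleftrightarrow> (\<exists>m. p \<in> admissible_with_ones m)"
proof
  assume "admissible p"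
  then obtain l k where lk: "l \<ge> 2" "1 \<le> k" "k \<le> l - 1" "count p 1 = l - 1" "2 * k \<in># p"
    "\<forall>x\<in>#p. even x \<longrightarrow> 2 * k \<le> x" "\<forall>x\<in>#p. x > 1 \<longrightarrow> x \<in> {2 * k..2 * l - 2}"
    "\<forall>x\<in>#p. odd x \<and> x > 1 \<longrightarrow> count p x = 1"
    unfolding admissible_def by blast
  define r where "r = filter_mset (\<lambda>x. x \<noteq> 1) p"
  have "p = replicate_mset (l - 1) 1 + r"
    unfolding r_def lk(4)[symmetric]
    by (rule multiset_eqI) (auto simp: count_eq_zero_iff)
  moreover have r_parts: "x > 1" if "x \<in># r" for x
  proof -
    have "0 \<notin># p" using lk(2,6) by fastforce
    with that show ?thesis unfolding r_def by (cases "x = 0") auto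
  qed
  have "r \<in> even_min_partitions (l - 1)"
  proof (rule even_min_partitionsI)
    show "1 \<le> k" "2 * k \<in># r" using lk by (auto simp: r_def)
    fix x assume x: "x \<in># r"
    then have "x \<in># p" "x \<noteq> 1" by (auto simp: r_def)
    with lk(7) r_parts[OF x] show "2 * k \<le> x" "x \<le> 2 * (l - 1)" by auto
    show "count r x = 1" if "odd x"
      using that \<open>x \<in># p\<close> r_parts[OF x] lk(8) by (auto simp: r_def)
  qed
  ultimately show "\<exists>m. p \<in> admissible_with_ones m"
    by (auto simp: admissible_with_ones_def funpow_add_mset)
next
  assume "\<exists>m. p \<in> admissible_with_ones m"
  then obtain m r where r: "r \<in> even_min_partitions m" "p = replicate_mset m 1 + r"
    and cnt: "count p 1 = m"
    using admissible_with_ones_count_1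
    by (metis admissible_with_ones_def funpow_add_mset imageE)
  from r(1) obtain k where k: "k \<ge> 1" "2 * k \<in># r" "\<forall>x\<in>#r. 2 * k \<le> x"
    and le: "\<forall>x\<in>#r. x \<le> 2 * m" and odd1: "\<forall>x\<in>#r. odd x \<longrightarrow> count r x = 1"
    by (auto simp: even_min_partitions_def)
  have "2 * k \<le> 2 * m" using k le by blast
  then have "k \<le> m" by simp
  have gt: "x \<in># r" if "x \<in># p" "x \<noteq> 1" for x
    using that r(2) by (auto simp: in_replicate_mset split: if_splits)
  show "admissible p"
    unfolding admissible_def
  proof (rule exI[of _ "m + 1"], rule exI[of _ k], intro conjI ballI impI)
    fix x assume x: "x \<in># p"
    show "2 * k \<le> x" if "even x" using gt[OF x] that k by fastforce
    show "x \<in> {2 * k..2 * (m + 1) - 2}" if "1 < x" using gt[OF x] that k le by auto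
    show "count p x = 1" if "odd x \<and> 1 < x"
      using gt[OF x] that odd1 r(2) by auto
  qed (use k \<open>k \<le> m\<close> cnt r(2) in auto)
qed

text \<open>
  A partition of \<open>n < N\<close> has fewer than \<open>N\<close> ones, so the union over \<open>m < N\<close> already
  contains every admissible partition that matters.  The two sides are added, not subtracted,
  because the signs of \<open>a2''\<close> and \<open>signed_gf\<close> are opposite.
\<close>
lemma a2''_gf_agrees:
  "fps_X ^ N dvd Abs_fps (\<lambda>n. of_int (a2'' n)) +
    (\<Sum>m<N. fps_X ^ m * signed_gf (even_min_partitions m))"
  unfolding fps_X_power_dvd_iff
proof (intro allI impI)
  fix n assume "n < N"
  have pos: "0 \<notin># p" if "p \<in> admissible_with_ones m" for p m
    using that even_min_partitions_parts_gt_1[of _ m 0]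
    by (auto simp: admissible_with_ones_def funpow_add_mset in_replicate_mset split: if_splits)
  have few_ones: "m < N" if "p \<in> admissible_with_ones m" "sum_mset p = n" for p m
  proof -
    have "m \<le> sum_mset p"
      using that(1) by (auto simp: admissible_with_ones_def funpow_add_mset)
    with that \<open>n < N\<close> show ?thesis by simp
  qed
  have "{p. p \<in> partitions_of n \<and> admissible p} =
      {p. p \<in> (\<Union>m\<in>{..<N}. admissible_with_ones m) \<and> sum_mset p = n}"
    using few_ones by (auto simp: admissible_iff partitions_of_def intro!: gr0I dest: pos)
  then have "of_int (a2'' n) = - (signed_gf (\<Union>m\<in>{..<N}. admissible_with_ones m) $ n)"
    by (simp add: a2''_def signed_gf_def sum_negf)
  also have "signed_gf (\<Union>m\<in>{..<N}. admissible_with_ones m) =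
      (\<Sum>m<N. signed_gf (admissible_with_ones m))"
    by (rule signed_gf_UN)
      (auto dest: pos admissible_with_ones_count_1)
  finally show "(Abs_fps (\<lambda>n. of_int (a2'' n)) +
      (\<Sum>m<N. fps_X ^ m * signed_gf (even_min_partitions m))) $ n = 0"
    by (simp add: signed_gf_admissible_with_ones)
qed

section \<open>The generating function identity\<close>

theorem theorem1:
  shows "Abs_fps (\<lambda>n. of_int (a2'' n)) =
    (fps_X / (1 - fps_X ^ 2) +
     1 / (1 + fps_X) *
       (\<Sum>n. fps_const (of_int (chi n)) * fps_X ^ ((n + 1 choose 2) + 1)) :: rat fps)"
proof -
  define A :: "rat fps" where "A = Abs_fps (\<lambda>n. of_int (a2'' n))"
  define t :: "nat \<Rightarrow> rat fps" where
    "t n = fps_const (of_int (chi n)) * fps_X ^ ((n + 1 choose 2) + 1)" for n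
  define R :: "rat fps" where "R = fps_X / (1 - fps_X\<^sup>2)"
  have R: "R * (1 - fps_X\<^sup>2) = fps_X"
    unfolding R_def by (simp add: fps_divide_unit mult.assoc inverse_mult_eq_1)
  have t_dvd: "fps_X ^ n dvd t n" for n
  proof -
    have "n \<le> (n + 1 choose 2) + 1" by (simp add: numeral_2_eq_2)
    then show ?thesis unfolding t_def by (intro dvd_mult le_imp_power_dvd)
  qed
  have "(1 + fps_X) * A = (1 + fps_X) * R + suminf t"
  proof (rule fps_eq_if_agree_mod_X_powers)
    fix N
    define W where "W = (\<Sum>m<N. fps_X ^ m * signed_gf (even_min_partitions m))"
    define G :: "rat fps" where "G = (\<Sum>n<N. qratio fps_X n * fps_X ^ n)"
    define T :: "rat fps" where "T = (\<Sum>m<N. (- 1) ^ m * fps_X ^ (2 * m\<^sup>2 + m) * (1 + fps_X ^ (2 * m + 1)))"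
    define S :: "rat fps" where "S = (\<Sum>m<N. fps_X ^ m)"
    have W_eq: "(1 + fps_X) * W = fps_X * G - fps_X * S"
    proof -
      have "(1 + fps_X) * W = (\<Sum>m<N. fps_X ^ m * ((1 + fps_X) * signed_gf (even_min_partitions m)))"
        unfolding W_def by (simp add: sum_distrib_left mult_ac)
      also have "\<dots> = fps_X * G - fps_X * S"
        unfolding signed_gf_even_min_partitions S_def G_def sum_distrib_left sum_subtractf[symmetric]
        by (rule sum.cong[OF refl]) algebra
      finally show ?thesis .
    qed
    have geom: "fps_X * S = (1 + fps_X) * R * (1 - fps_X ^ N)"
    proof -
      have "fps_X * (S * (1 - fps_X)) = R * (1 - fps_X\<^sup>2) * (1 - fps_X ^ N)"
        unfolding R S_def using one_diff_power_eq[of "fps_X :: rat fps" N] by (simp add: mult.commute)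
      then have "fps_X * S * (1 - fps_X) = (1 + fps_X) * R * (1 - fps_X ^ N) * (1 - fps_X)"
        by (simp add: algebra_simps power2_eq_square)
      then show ?thesis by (rule fps_mult_right_cancel_unit[rotated]) simp
    qed
    \<comment> \<open>Twice as many terms as needed, because the exponents on the other side come in pairs.\<close>
    have "fps_X ^ N dvd suminf t - (\<Sum>n<2 * N. t n)"
      using suminf_fps_agrees_partial_sum[OF t_dvd, of "2 * N"]
      by (rule dvd_trans[rotated]) (simp add: le_imp_power_dvd)
    then have theta: "fps_X ^ N dvd suminf t + fps_X * T"
      unfolding t_def sum_chi_pairs T_def by simp
    have "(1 + fps_X) * A - ((1 + fps_X) * R + suminf t) =
        (1 + fps_X) * (A + W) - fps_X * (G - T) - (suminf t + fps_X * T)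
        - (1 + fps_X) * R * fps_X ^ N"
    proof -
      have "(1 + fps_X) * (A + W) - fps_X * (G - T) - (suminf t + fps_X * T) =
          (1 + fps_X) * A - fps_X * S - suminf t"
        using W_eq by (simp add: algebra_simps)
      then show ?thesis unfolding geom by (simp add: algebra_simps)
    qed
    moreover have "fps_X ^ N dvd A + W" "fps_X ^ N dvd G - T"
      using a2''_gf_agrees[of N] false_theta_expansion[of N]
      unfolding A_def W_def G_def T_def by simp_all
    then have "fps_X ^ N dvd (1 + fps_X) * (A + W) - fps_X * (G - T) - (suminf t + fps_X * T)
        - (1 + fps_X) * R * fps_X ^ N"
      using theta by (intro dvd_diff[OF dvd_diff[OF dvd_diff]] dvd_mult) simp_all
    ultimately show "fps_X ^ N dvd (1 + fps_X) * A - ((1 + fps_X) * R + suminf t)" by (simp only:)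
  qed
  moreover have "(1 / (1 + fps_X)) * (1 + fps_X) = (1 :: rat fps)"
    by (simp add: fps_divide_unit inverse_mult_eq_1)
  ultimately have "A = R + 1 / (1 + fps_X) * suminf t"
    by algebra
  then show ?thesis by (simp only: A_def R_def t_def[abs_def])
qed

end
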